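(* Let $$D(x,y,z)=\sum_{n\ge0}\ \sum_{D\in\mathcal D_n}\ \sum_{(a,b)\in V(D)} x^a y^b z^n .$$ Then $$D(x,y,z)=\frac{C(z)}{1-xyzC(z)-x^2zC(x^2z)}=\frac{1-\sqrt{1-4z}}{z\left(1-xy+xy\sqrt{1-4z}+\sqrt{1-4x^2z}\right)}.$$
   Context: A Dyck path of semilength $n$ is a lattice path in $\mathbb Z^2$ with steps $(1,1)$ and $(1,-1)$ that starts at $(0,0)$, ends at $(2n,0)$, and never goes below the $x$-axis. $\mathcal D_n$ is the set of Dyck paths of semilength $n$. For $D\in\mathcal D_n$, $V(D)$ is its set of $2n+1$ vertices (lattice points visited), given in Cartesian coordinates. $C(z)=\sum_{n\ge0}\frac{1}{n+1}\binom{2n}{n}z^n=\frac{1-\sqrt{1-4z}}{2z}$ is the Catalan generating function. The identities are between formal power series in $z$ with coefficients polynomial in $x,y$. *)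

theory Defs
  imports "HOL-Computational_Algebra.Computational_Algebra"
begin

text \<open>A lattice path is represented by its sequence of vertices.\<close>

definition dyck_paths :: "nat \<Rightarrow> (int \<times> int) list set" where
  "dyck_paths n = {p. p \<noteq> [] \<and> hd p = (0, 0) \<and> last p = (2 * int n, 0) \<and>
     (\<forall>i. Suc i < length p \<longrightarrow>
        p ! Suc i = (fst (p ! i) + 1, snd (p ! i) + 1) \<or>
        p ! Suc i = (fst (p ! i) + 1, snd (p ! i) - 1)) \<and>
     (\<forall>v\<in>set p. 0 \<le> snd v)}"

definition vertices :: "(int \<times> int) list \<Rightarrow> (int \<times> int) set" where
  "vertices p = set p"

lemma dyck_path_fst:
  assumes "p \<in> dyck_paths n" "i < length p"
  shows "fst (p ! i) = int i"
  using assms(2)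
proof (induction i)
  case 0
  then show ?case using assms(1) by (auto simp: dyck_paths_def hd_conv_nth)
next
  case (Suc i)
  then have "p ! Suc i = (fst (p ! i) + 1, snd (p ! i) + 1) \<or>
        p ! Suc i = (fst (p ! i) + 1, snd (p ! i) - 1)"
    using assms(1) unfolding dyck_paths_def by blast
  then show ?case using Suc by auto
qed

lemma dyck_path_snd:
  assumes "p \<in> dyck_paths n" "i < length p"
  shows "snd (p ! i) \<le> int i"
  using assms(2)
proof (induction i)
  case 0
  then show ?case using assms(1) by (auto simp: dyck_paths_def hd_conv_nth)
next
  case (Suc i)
  then have "p ! Suc i = (fst (p ! i) + 1, snd (p ! i) + 1) \<or>
        p ! Suc i = (fst (p ! i) + 1, snd (p ! i) - 1)"
    using assms(1) unfolding dyck_paths_def by blast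
  then show ?case using Suc by auto
qed

lemma dyck_path_length:
  assumes "p \<in> dyck_paths n"
  shows "length p = 2 * n + 1"
proof -
  have ne: "p \<noteq> []" and l: "last p = (2 * int n, 0)"
    using assms by (auto simp: dyck_paths_def)
  have "fst (p ! (length p - 1)) = int (length p - 1)"
    using dyck_path_fst[OF assms, of "length p - 1"] ne by simp
  with l have "2 * int n = int (length p - 1)" by (simp add: last_conv_nth ne)
  moreover have "length p > 0" using ne by simp
  ultimately show ?thesis by linarith
qed

lemma dyck_path_vertices:
  assumes "p \<in> dyck_paths n"
  shows "vertices p \<subseteq> {0..2 * int n} \<times> {0..2 * int n}"
proof
  fix v assume "v \<in> vertices p"
  then obtain i where i: "i < length p" "v = p ! i"
    by (auto simp: vertices_def in_set_conv_nth)
  have "0 \<le> snd v" using assms i by (auto simp: dyck_paths_def)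
  then show "v \<in> {0..2 * int n} \<times> {0..2 * int n}"
    using dyck_path_fst[OF assms i(1)] dyck_path_snd[OF assms i(1)]
      dyck_path_length[OF assms] i by (auto simp: mem_Times_iff)
qed

lemma card_vertices:
  assumes "p \<in> dyck_paths n"
  shows "card (vertices p) = 2 * n + 1"
proof -
  have "distinct p"
    unfolding distinct_conv_nth using dyck_path_fst[OF assms] by (metis of_nat_eq_iff)
  then show ?thesis
    using dyck_path_length[OF assms] by (simp add: vertices_def distinct_card)
qed

lemma finite_dyck_paths: "finite (dyck_paths n)"
proof (rule finite_subset)
  show "dyck_paths n \<subseteq> {p. set p \<subseteq> {0..2 * int n} \<times> {0..2 * int n} \<and> length p = 2 * n + 1}"
    using dyck_path_vertices dyck_path_length unfolding vertices_def by blast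
qed (auto intro: finite_lists_length_eq)

text \<open>
  The polynomial ring \<open>\<int>[x,y]\<close> is \<open>int poly poly\<close>, with inner variable \<open>x\<close> and outer
  variable \<open>y\<close>. The exponents \<open>nat a\<close>, \<open>nat b\<close> below lose nothing, since vertices of Dyck
  paths have nonnegative coordinates (lemma \<open>dyck_path_vertices\<close>).
\<close>

definition poly_x :: "int poly poly" where "poly_x = [:[:0, 1:]:]"

definition poly_y :: "int poly poly" where "poly_y = [:0, 1:]"

definition dyck_coeff :: "nat \<Rightarrow> int poly poly" where
  "dyck_coeff n =
     (\<Sum>p\<in>dyck_paths n. \<Sum>(a, b)\<in>vertices p. poly_x ^ nat a * poly_y ^ nat b)"

text \<open>
  Division and \<open>fps_radical\<close> on power series need coefficients in a field, so the polynomials are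
  embedded into the fraction field of \<open>\<int>[x,y]\<close>. The elements \<open>fps_x\<close> and \<open>fps_y\<close> are constant as
  power series; the series variable \<open>z\<close> is \<open>fps_X\<close>.
\<close>

type_synonym series = "int poly poly fract fps"

definition fps_x :: series where "fps_x = fps_const (Fract poly_x 1)"

definition fps_y :: series where "fps_y = fps_const (Fract poly_y 1)"

definition dyck_gf :: series where
  "dyck_gf = Abs_fps (\<lambda>n. Fract (dyck_coeff n) 1)"

definition catalan_gf :: "'a::field_char_0 fps" where
  "catalan_gf = Abs_fps (\<lambda>n. of_nat ((2 * n) choose n) / of_nat (n + 1))"

text \<open>
  To be used only for series with constant term 1; it is then the square root with constant term 1,
  the root function \<open>\<lambda>_ _. 1\<close> merely selecting the root of the constant term.
\<close>

definition fps_sqrt :: "'a::field_char_0 fps \<Rightarrow> 'a fps" where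
  "fps_sqrt f = fps_radical (\<lambda>_ _. 1) 2 f"

lemma fps_sqrt:
  fixes f :: "'a::field_char_0 fps"
  assumes "fps_nth f 0 = 1"
  shows "fps_sqrt f ^ 2 = f" and "fps_nth (fps_sqrt f) 0 = 1"
  using power_radical[of f "\<lambda>_ _. 1" 1] assms
  by (simp_all add: fps_sqrt_def numeral_2_eq_2)

end

theory Submission
  imports Defs "HOL-Library.Product_Plus"
begin

text \<open>
  A nonempty Dyck path splits uniquely at its first return to the axis: it is an up step, a
  shifted Dyck path \<open>P\<close>, a down step and a shifted Dyck path \<open>Q\<close>. On vertex lists it is the
  origin, followed by \<open>P\<close> moved by \<open>(1, 1)\<close>, followed by \<open>Q\<close> moved by \<open>(2k + 2, 0)\<close>, where \<open>k\<close>
  is the semilength of \<open>P\<close>; this is a bijection (\<open>bij_betw_first_return_join\<close>).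

  Now mark a vertex. The marked vertex is the origin, or it lies in the copy of \<open>P\<close> and
  contributes an extra factor \<open>xy\<close>, or it lies in the copy of \<open>Q\<close> and contributes an extra factor
  \<open>x^(2k + 2)\<close>. Paths with the origin marked are counted by \<open>C(z)\<close>, the empty path included, so
  \<open>D = C(z) + x y z C(z) D + x^2 z C(x^2 z) D\<close>,
  which is \<open>dyck_gf_functional_equation\<close>; the factors \<open>x^(2k)\<close> turn \<open>C(z)\<close> into \<open>C(x^2 z)\<close> in the
  last term. Solving for \<open>D\<close> gives the first formula.

  The same bijection without marks gives the Catalan convolution for the number of Dyck paths.
  That the binomial expression satisfies this convolution follows from
  \<open>(1 - 2 z C)^2 = 1 - 4 z\<close>, which is proved through a differential equation. This square also
  gives \<open>1 - 2 w C(w) = sqrt (1 - 4 w)\<close>; with \<open>w = z\<close> and \<open>w = x^2 z\<close> the second formula is the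
  first one with numerator and denominator multiplied by \<open>2 z\<close>.
\<close>

section \<open>First-return decomposition\<close>

definition dyck_step :: "int \<times> int \<Rightarrow> int \<times> int \<Rightarrow> bool" where
  "dyck_step u v \<longleftrightarrow> v - u = (1, 1) \<or> v - u = (1, -1)"

lemma dyck_paths_iff:
  "p \<in> dyck_paths n \<longleftrightarrow> p \<noteq> [] \<and> hd p = (0, 0) \<and> last p = (2 * int n, 0) \<and>
     successively dyck_step p \<and> (\<forall>v\<in>set p. 0 \<le> snd v)"
proof -
  have "dyck_step u v \<longleftrightarrow> v = (fst u + 1, snd u + 1) \<or> v = (fst u + 1, snd u - 1)" for u v
    by (cases u; cases v) (auto simp: dyck_step_def)
  then show ?thesis
    by (simp add: dyck_paths_def successively_conv_nth)
qed

lemma dyck_step_translate [simp]: "dyck_step (w + u) (w + v) \<longleftrightarrow> dyck_step u v"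
  by (simp add: dyck_step_def)

lemma dyck_step_Pair [simp]:
  "dyck_step (a, b) (c, d) \<longleftrightarrow> c = a + 1 \<and> (d = b + 1 \<or> d = b - 1)"
  by (auto simp: dyck_step_def)

lemma successively_translate:
  "successively dyck_step (map ((+) w) p) \<longleftrightarrow> successively dyck_step p"
  by (simp add: successively_map)

text \<open>
  Every step preserves the parity of the coordinate sum, so a return to the axis can only happen
  at an even abscissa and the first component of the decomposition has an integral semilength.
\<close>

lemma dyck_steps_parity:
  assumes "successively dyck_step p" "p \<noteq> []" "v \<in> set p"
  shows "even (fst v + snd v) \<longleftrightarrow> even (fst (hd p) + snd (hd p))"
  using assms
proof (induction p rule: induct_list012)
  case (3 u w p)
  have "even (fst w + snd w) \<longleftrightarrow> even (fst u + snd u)"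
    using "3.prems"(1) by (cases u; cases w) (auto simp: dyck_step_def algebra_simps; presburger)
  with 3 show ?case by auto
qed auto

text \<open>
  The vertex list of a Dyck path of semilength \<open>k\<close> has length \<open>2k + 1\<close>, so \<open>Q\<close> is placed at abscissa \<open>2k + 2\<close>.
  The origin of \<open>Q\<close> becomes the end point of the down step that closes the arch over \<open>P\<close>.
\<close>

definition first_return_join ::
  "(int \<times> int) list \<Rightarrow> (int \<times> int) list \<Rightarrow> (int \<times> int) list" where
  "first_return_join P Q =
     (0, 0) # map ((+) (1, 1)) P @ map ((+) (int (length P) + 1, 0)) Q"

lemma first_return_join_in_dyck_paths:
  assumes P: "P \<in> dyck_paths k" and Q: "Q \<in> dyck_paths m"
  shows "first_return_join P Q \<in> dyck_paths (Suc (k + m))"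
proof -
  note l = dyck_path_length[OF P]
  show ?thesis
    using P Q unfolding dyck_paths_iff first_return_join_def
    by (auto simp: successively_Cons successively_append_iff successively_translate
        hd_append hd_map last_map l)
qed

text \<open>
  The components can be recovered because the raised copy of \<open>P\<close> stays strictly above the axis,
  while the copy of \<open>Q\<close> starts on it.
\<close>

lemma first_return_join_components:
  assumes P: "P \<in> dyck_paths k" and Q: "Q \<in> dyck_paths m"
  shows "takeWhile (\<lambda>v. 0 < snd v) (tl (first_return_join P Q)) = map ((+) (1, 1)) P"
    and "dropWhile (\<lambda>v. 0 < snd v) (tl (first_return_join P Q)) =
           map ((+) (int (length P) + 1, 0)) Q"
proof -
  have pos: "0 < snd v" if "v \<in> set (map ((+) (1, 1)) P)" for v
    using that P by (auto simp: dyck_paths_iff)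
  obtain Q' where Q': "Q = (0, 0) # Q'"
    using Q by (cases Q) (auto simp: dyck_paths_iff)
  show "takeWhile (\<lambda>v. 0 < snd v) (tl (first_return_join P Q)) = map ((+) (1, 1)) P"
    unfolding first_return_join_def list.sel
    by (subst takeWhile_append2) (use pos in \<open>auto simp: Q'\<close>)
  show "dropWhile (\<lambda>v. 0 < snd v) (tl (first_return_join P Q)) =
           map ((+) (int (length P) + 1, 0)) Q"
    unfolding first_return_join_def list.sel
    by (subst dropWhile_append2) (use pos in \<open>auto simp: Q'\<close>)
qed

text \<open>
  Cutting after the longest stretch \<open>A\<close> above the axis leaves a rest \<open>B\<close> that starts at the first
  return \<open>(h, 0)\<close>. The steps at both ends of \<open>A\<close> are forced, so \<open>A\<close> runs from \<open>(1, 1)\<close> to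
  \<open>(h - 1, 1)\<close>, and moving the two pieces back to the origin yields Dyck paths.
\<close>

lemma first_return_decomposition:
  assumes p: "p \<in> dyck_paths (Suc n)"
  obtains k P Q where "k \<le> n" "P \<in> dyck_paths k" "Q \<in> dyck_paths (n - k)"
    "p = first_return_join P Q"
proof -
  define A where "A = takeWhile (\<lambda>v. 0 < snd v) (tl p)"
  define B where "B = dropWhile (\<lambda>v. 0 < snd v) (tl p)"
  have AB: "tl p = A @ B" by (simp add: A_def B_def)
  note pD = p[unfolded dyck_paths_iff]
  have p_eq: "p = (0, 0) # A @ B"
    using pD AB by (cases p) auto
  have ne: "A @ B \<noteq> []"
    using pD by (auto simp: p_eq)
  have last: "last (A @ B) = (2 * int n + 2, 0)"
    using pD ne unfolding p_eq by (auto simp del: last_append split: if_splits)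
  have "\<exists>v\<in>set (tl p). \<not> 0 < snd v"
    unfolding AB by (intro bexI[OF _ last_in_set[OF ne]]) (simp add: last del: last_append)
  then have B: "B \<noteq> []" by (auto simp: B_def dropWhile_eq_Nil_conv)
  then have hdB: "snd (hd B) \<le> 0"
    using hd_dropWhile[of "\<lambda>v. 0 < snd v" "tl p"] by (auto simp: B_def)
  then have hdB0: "snd (hd B) = 0"
    using pD B by (auto simp: p_eq intro!: antisym)
  have "dyck_step (0, 0) (hd (A @ B))"
    using pD ne unfolding p_eq by (auto simp: successively_Cons simp del: hd_append2)
  moreover have "0 \<le> snd (hd (A @ B))"
    using pD hd_in_set[OF ne] unfolding p_eq by auto
  ultimately have hdAB: "hd (A @ B) = (1, 1)"
    by (cases "hd (A @ B)") auto
  then have A: "A \<noteq> []" using hdB by auto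
  then have hdA: "hd A = (1, 1)" using hdAB by simp
  have Apos: "0 < snd v" if "v \<in> set A" for v
    using set_takeWhileD[of v "\<lambda>v. 0 < snd v" "tl p"] that by (auto simp: A_def)
  have succA: "successively dyck_step A" and succB: "successively dyck_step B"
    and mid: "dyck_step (last A) (hd B)"
    using pD A B unfolding p_eq by (auto simp: successively_Cons successively_append_iff)
  define h where "h = fst (hd B)"
  have hdB_eq: "hd B = (h, 0)" using hdB0 by (simp add: h_def prod_eq_iff)
  have h: "h = int (length A) + 1"
    using dyck_path_fst[OF p, of "length A + 1"] B
    by (simp add: p_eq nth_append h_def hd_conv_nth)
  have lastA: "last A = (h - 1, 1)"
    using mid Apos[OF last_in_set[OF A]] by (cases "last A") (auto simp: hdB_eq)
  have "even h"
    using dyck_steps_parity[of p "hd B"] pD hdB_eq hd_in_set[OF B] by (auto simp: p_eq)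
  moreover have "h \<le> 2 * int n + 2"
    using dyck_path_vertices[OF p] hdB_eq hd_in_set[OF B] by (auto simp: p_eq vertices_def)
  moreover have "h \<ge> 2" using h A by (cases A) auto
  ultimately have "h = 2 * int (nat (h div 2 - 1)) + 2" "nat (h div 2 - 1) \<le> n"
    by auto
  then obtain k where k: "h = 2 * int k + 2" "k \<le> n"
    by blast
  define P where "P = map ((+) (-1, -1)) A"
  define Q where "Q = map ((+) (-h, 0)) B"
  have "P \<in> dyck_paths k"
    using A hdA lastA succA Apos unfolding dyck_paths_iff P_def
    by (auto simp: successively_translate hd_map last_map k)
  moreover have "Q \<in> dyck_paths (n - k)"
    using B hdB_eq last succB pD k unfolding dyck_paths_iff Q_def
    by (auto simp: successively_translate hd_map last_map p_eq of_nat_diff)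
  moreover have "p = first_return_join P Q"
    by (auto simp: p_eq first_return_join_def P_def Q_def h intro!: map_idI[symmetric])
  ultimately show ?thesis using that k by blast
qed

lemma bij_betw_first_return_join:
  "bij_betw (\<lambda>(k, P, Q). first_return_join P Q)
     (SIGMA k:{..n}. dyck_paths k \<times> dyck_paths (n - k)) (dyck_paths (Suc n))"
proof (rule bij_betw_imageI)
  show "inj_on (\<lambda>(k, P, Q). first_return_join P Q)
          (SIGMA k:{..n}. dyck_paths k \<times> dyck_paths (n - k))"
  proof (rule inj_onI, clarsimp)
    fix k P Q k' P' Q'
    assume P: "P \<in> dyck_paths k" "P' \<in> dyck_paths k'"
      and Q: "Q \<in> dyck_paths (n - k)" "Q' \<in> dyck_paths (n - k')"
      and eq: "first_return_join P Q = first_return_join P' Q'"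
    have "map ((+) (1, 1)) P = map ((+) (1, 1)) P'"
      using first_return_join_components(1)[OF P(1) Q(1), unfolded eq]
      by (rule trans[OF sym first_return_join_components(1)[OF P(2) Q(2)]])
    then have PP: "P = P'"
      by (simp add: inj_map_eq_map)
    have "map ((+) (int (length P') + 1, 0)) Q = map ((+) (int (length P') + 1, 0)) Q'"
      using first_return_join_components(2)[OF P(1) Q(1), unfolded eq, unfolded PP]
      by (rule trans[OF sym first_return_join_components(2)[OF P(2) Q(2)]])
    then have "Q = Q'"
      by (simp add: inj_map_eq_map)
    moreover have "k = k'"
      using dyck_path_length[OF P(1)] dyck_path_length[OF P(2)] PP by simp
    ultimately show "k = k' \<and> P = P' \<and> Q = Q'"
      using PP by simp
  qed
  show "(\<lambda>(k, P, Q). first_return_join P Q) `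
          (SIGMA k:{..n}. dyck_paths k \<times> dyck_paths (n - k)) = dyck_paths (Suc n)"
  proof (intro equalityI subsetI)
    fix p assume "p \<in> (\<lambda>(k, P, Q). first_return_join P Q) `
      (SIGMA k:{..n}. dyck_paths k \<times> dyck_paths (n - k))"
    then obtain k P Q where "k \<le> n" "P \<in> dyck_paths k" "Q \<in> dyck_paths (n - k)"
      "p = first_return_join P Q" by auto
    then show "p \<in> dyck_paths (Suc n)"
      using first_return_join_in_dyck_paths[of P k Q "n - k"] by simp
  next
    fix p assume "p \<in> dyck_paths (Suc n)"
    then obtain k P Q where "k \<le> n" "P \<in> dyck_paths k" "Q \<in> dyck_paths (n - k)"
      "p = first_return_join P Q" by (rule first_return_decomposition)
    then show "p \<in> (\<lambda>(k, P, Q). first_return_join P Q) `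
      (SIGMA k:{..n}. dyck_paths k \<times> dyck_paths (n - k))"
      by (intro image_eqI[of _ _ "(k, P, Q)"]) auto
  qed
qed

lemma sum_dyck_paths_Suc:
  fixes f :: "(int \<times> int) list \<Rightarrow> 'a::comm_monoid_add"
  shows "(\<Sum>p\<in>dyck_paths (Suc n). f p) =
    (\<Sum>k\<le>n. \<Sum>P\<in>dyck_paths k. \<Sum>Q\<in>dyck_paths (n - k). f (first_return_join P Q))"
proof -
  have "(\<Sum>p\<in>dyck_paths (Suc n). f p) =
      (\<Sum>(k, P, Q)\<in>(SIGMA k:{..n}. dyck_paths k \<times> dyck_paths (n - k)). f (first_return_join P Q))"
    by (subst sum.reindex_bij_betw[OF bij_betw_first_return_join, symmetric])
       (simp add: case_prod_unfold)
  then show ?thesis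
    by (simp add: sum.Sigma sum.cartesian_product finite_dyck_paths)
qed

lemma dyck_paths_0: "dyck_paths 0 = {[(0, 0)]}"
proof (intro equalityI subsetI)
  fix p assume p: "p \<in> dyck_paths 0"
  then have "length p = Suc 0" using dyck_path_length by fastforce
  then show "p \<in> {[(0, 0)]}" using p by (auto simp: length_Suc_conv dyck_paths_iff)
qed (simp add: dyck_paths_iff)

lemma card_dyck_paths_Suc:
  "card (dyck_paths (Suc n)) = (\<Sum>k\<le>n. card (dyck_paths k) * card (dyck_paths (n - k)))"
  using sum_dyck_paths_Suc[of "\<lambda>_. 1::nat" n] by simp

section \<open>Marked vertices\<close>

definition monomial_xy :: "int \<times> int \<Rightarrow> int poly poly" where
  "monomial_xy v = poly_x ^ nat (fst v) * poly_y ^ nat (snd v)"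

definition path_weight :: "(int \<times> int) list \<Rightarrow> int poly poly" where
  "path_weight p = (\<Sum>v\<leftarrow>p. monomial_xy v)"

lemma dyck_coeff_path_weight: "dyck_coeff n = (\<Sum>p\<in>dyck_paths n. path_weight p)"
  unfolding dyck_coeff_def
proof (intro sum.cong refl)
  fix p assume p: "p \<in> dyck_paths n"
  then have "distinct p"
    using card_vertices[OF p] dyck_path_length[OF p] by (simp add: vertices_def card_distinct)
  then show "(\<Sum>(a, b)\<in>vertices p. poly_x ^ nat a * poly_y ^ nat b) = path_weight p"
    by (simp add: path_weight_def vertices_def sum_list_distinct_conv_sum_set monomial_xy_def
        case_prod_unfold)
qed

lemma path_weight_translate:
  assumes "p \<in> dyck_paths n" "0 \<le> a" "0 \<le> b"
  shows "path_weight (map ((+) (a, b)) p) = monomial_xy (a, b) * path_weight p"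
proof -
  have "monomial_xy ((a, b) + v) = monomial_xy (a, b) * monomial_xy v" if "v \<in> set p" for v
    using dyck_path_vertices[OF assms(1)] assms that
    by (cases v) (auto simp: monomial_xy_def vertices_def nat_add_distrib power_add)
  then have "path_weight (map ((+) (a, b)) p) = (\<Sum>v\<leftarrow>p. monomial_xy (a, b) * monomial_xy v)"
    unfolding path_weight_def map_map o_def by (intro arg_cong[of _ _ sum_list] map_cong) auto
  then show ?thesis
    by (simp add: path_weight_def sum_list_const_mult)
qed

lemma path_weight_first_return_join:
  assumes "P \<in> dyck_paths k" "Q \<in> dyck_paths m"
  shows "path_weight (first_return_join P Q) =
    1 + poly_x * poly_y * path_weight P + poly_x ^ (2 * Suc k) * path_weight Q"
proof -
  have "int (length P) + 1 = 2 + 2 * int k"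
    by (simp add: dyck_path_length[OF assms(1)])
  then have "path_weight (first_return_join P Q) = monomial_xy (0, 0)
      + path_weight (map ((+) (1, 1)) P) + path_weight (map ((+) (2 + 2 * int k, 0)) Q)"
    by (simp add: first_return_join_def path_weight_def add.assoc)
  moreover have "nat (2 + 2 * int k) = 2 * Suc k" by simp
  ultimately show ?thesis
    using path_weight_translate[OF assms(1), of 1 1]
      path_weight_translate[OF assms(2), of "2 + 2 * int k" 0]
    by (simp add: monomial_xy_def)
qed

lemma dyck_coeff_0: "dyck_coeff 0 = 1"
  by (simp add: dyck_coeff_path_weight dyck_paths_0 path_weight_def monomial_xy_def)

lemma dyck_coeff_Suc:
  "dyck_coeff (Suc n) = of_nat (card (dyck_paths (Suc n)))
     + poly_x * poly_y * (\<Sum>k\<le>n. dyck_coeff k * of_nat (card (dyck_paths (n - k))))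
     + (\<Sum>k\<le>n. poly_x ^ (2 * Suc k) * of_nat (card (dyck_paths k)) * dyck_coeff (n - k))"
proof -
  have "dyck_coeff (Suc n) = (\<Sum>k\<le>n. \<Sum>P\<in>dyck_paths k. \<Sum>Q\<in>dyck_paths (n - k).
      1 + poly_x * poly_y * path_weight P + poly_x ^ (2 * Suc k) * path_weight Q)"
    unfolding dyck_coeff_path_weight sum_dyck_paths_Suc
    by (intro sum.cong refl) (rule path_weight_first_return_join; assumption)
  also have "\<dots> = (\<Sum>k\<le>n. of_nat (card (dyck_paths k) * card (dyck_paths (n - k)))
      + poly_x * poly_y * (dyck_coeff k * of_nat (card (dyck_paths (n - k))))
      + poly_x ^ (2 * Suc k) * of_nat (card (dyck_paths k)) * dyck_coeff (n - k))"
    by (intro sum.cong refl)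
       (simp add: sum.distrib dyck_coeff_path_weight sum_distrib_left sum_distrib_right algebra_simps)
  also have "\<dots> = of_nat (card (dyck_paths (Suc n)))
     + poly_x * poly_y * (\<Sum>k\<le>n. dyck_coeff k * of_nat (card (dyck_paths (n - k))))
     + (\<Sum>k\<le>n. poly_x ^ (2 * Suc k) * of_nat (card (dyck_paths k)) * dyck_coeff (n - k))"
    by (simp add: sum.distrib sum_distrib_left card_dyck_paths_Suc)
  finally show ?thesis .
qed

section \<open>The Catalan generating function\<close>

lemma central_binomial_Suc:
  "Suc n * ((2 * Suc n) choose Suc n) = 2 * (2 * n + 1) * ((2 * n) choose n)"
proof -
  have "Suc n * ((2 * Suc n) choose Suc n) = (2 * Suc n) * ((2 * n + 1) choose n)"
    using Suc_times_binomial[of n "2 * n + 1"] by simp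
  also have "(2 * n + 1) choose n = Suc (2 * n) choose Suc n"
    using binomial_symmetric[of n "2 * n + 1"] by simp
  finally have "Suc n * (Suc n * ((2 * Suc n) choose Suc n)) =
      2 * Suc n * (Suc n * (Suc (2 * n) choose Suc n))"
    by (simp only: mult_ac)
  also have "Suc n * (Suc (2 * n) choose Suc n) = Suc (2 * n) * ((2 * n) choose n)"
    by (rule Suc_times_binomial)
  finally have "Suc n * (Suc n * ((2 * Suc n) choose Suc n)) =
      Suc n * (2 * (2 * n + 1) * ((2 * n) choose n))"
    by (simp only: mult_ac Suc_eq_plus1)
  then show ?thesis
    by (simp only: mult_cancel_left nat.simps simp_thms)
qed

text \<open>
  In an integral domain a square determines its root up to sign; the constant term fixes the sign.
\<close>

lemma fps_square_eq_imp_eq: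
  fixes f g :: "'a::field_char_0 fps"
  assumes "f ^ 2 = g ^ 2" "fps_nth f 0 = 1" "fps_nth g 0 = 1"
  shows "f = g"
proof -
  have "f \<noteq> - g"
    using assms(2,3) by (metis fps_neg_nth one_neq_neg_one)
  then show ?thesis using assms(1) by (auto simp: power2_eq_iff)
qed

text \<open>
  The ratio of consecutive central binomial coefficients says that \<open>S = 1 - 2 z C\<close> satisfies
  \<open>(1 - 4 z) S' = - 2 S\<close>, the differential equation of the square root of \<open>1 - 4 z\<close>. Hence the
  quotient of \<open>S^2\<close> by \<open>1 - 4 z\<close> has derivative zero and is the constant 1.
\<close>

lemma one_minus_two_X_catalan_gf_squared:
  "(1 - 2 * fps_X * catalan_gf) ^ 2 = (1 - 4 * fps_X :: 'a::field_char_0 fps)"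
proof -
  define S :: "'a fps" where "S = 1 - 2 * fps_X * catalan_gf"
  define T :: "'a fps" where "T = 1 - 4 * fps_X"
  have T0: "fps_nth T 0 = 1" by (simp add: T_def)
  have ode: "fps_deriv S * T = - 2 * S"
  proof (rule fps_ext)
    fix n
    have S_nth: "fps_nth S m = (if m = 0 then 1 else
        - 2 * (of_nat ((2 * (m - 1)) choose (m - 1)) / of_nat m))" for m
      by (cases m) (simp_all add: S_def catalan_gf_def mult.assoc numeral_fps_const)
    have S'_nth: "fps_nth (fps_deriv S) m = - 2 * of_nat ((2 * m) choose m)" for m
      by (simp add: S_nth del: of_nat_Suc)
    have L: "fps_nth (fps_deriv S * T) m = fps_nth (fps_deriv S) m -
        (if m = 0 then 0 else 4 * fps_nth (fps_deriv S) (m - 1))" for m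
      by (simp add: T_def algebra_simps numeral_fps_const)
    show "fps_nth (fps_deriv S * T) n = fps_nth (- 2 * S) n"
    proof (cases n)
      case 0
      then show ?thesis by (simp add: L S'_nth S_nth T0 numeral_fps_const)
    next
      case (Suc m)
      define b b' q :: 'a where "b = of_nat ((2 * m) choose m)"
        and "b' = of_nat ((2 * Suc m) choose Suc m)" and "q = of_nat (Suc m)"
      have q: "q \<noteq> 0" by (simp add: q_def del: of_nat_Suc)
      have "q * b' = of_nat (2 * (2 * m + 1) * ((2 * m) choose m))"
        unfolding q_def b'_def of_nat_mult[symmetric] central_binomial_Suc ..
      also have "\<dots> = 2 * (2 * q - 1) * b"
        by (simp add: q_def b_def algebra_simps)
      finally have b': "b' = 2 * (2 * q - 1) * b / q"
        using q by (simp add: field_simps)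
      have "fps_nth (fps_deriv S * T) n = - 2 * b' + 8 * b"
        unfolding L S'_nth Suc by (simp add: b_def b'_def del: binomial_Suc_Suc mult_Suc_right)
      also have "\<dots> = - 2 * (- 2 * (b / q))"
        using q by (simp add: b' field_simps)
      also have "- 2 * (b / q) = fps_nth S n"
        by (simp add: S_nth Suc b_def q_def del: of_nat_Suc)
      also have "- 2 * fps_nth S n = fps_nth (- 2 * S) n"
        by (simp add: numeral_fps_const fps_const_neg [symmetric] del: fps_const_neg)
      finally show ?thesis .
    qed
  qed
  have unit: "inverse T * T = 1"
    using T0 by (simp add: inverse_mult_eq_1)
  have "fps_deriv (S ^ 2 * inverse T) =
      2 * S * fps_deriv S * inverse T - S ^ 2 * fps_deriv T * inverse T ^ 2"
    using T0 by (simp add: fps_inverse_deriv power2_eq_square algebra_simps)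
  also have "fps_deriv T = - 4"
    by (simp add: T_def)
  also have "2 * S * fps_deriv S * inverse T - S ^ 2 * - 4 * inverse T ^ 2 = 0"
    using ode unit by algebra
  finally have "fps_deriv (S ^ 2 * inverse T) = 0" .
  then have "S ^ 2 * inverse T = fps_const (fps_nth (S ^ 2 * inverse T) 0)"
    by (simp only: fps_deriv_eq_0_iff)
  also have "fps_nth (S ^ 2 * inverse T) 0 = 1"
    by (simp add: S_def T_def power2_eq_square)
  finally have "S ^ 2 * inverse T = 1" by simp
  then have "S ^ 2 * (inverse T * T) = T"
    by (simp add: mult.assoc [symmetric])
  then show ?thesis
    using T0 by (simp add: inverse_mult_eq_1 S_def T_def)
qed

lemma catalan_gf_quadratic: "catalan_gf = 1 + fps_X * (catalan_gf :: 'a::field_char_0 fps) ^ 2"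
proof -
  have "4 * fps_X * (catalan_gf :: 'a fps) = 4 * fps_X * (1 + fps_X * catalan_gf ^ 2)"
    using one_minus_two_X_catalan_gf_squared[where 'a = 'a] by algebra
  then show ?thesis by simp
qed

text \<open>
  Both sequences start with 1 and obey the same convolution: for the Dyck paths it is the
  first-return decomposition, for the Catalan series it is the quadratic equation.
\<close>

lemma of_nat_card_dyck_paths:
  "of_nat (card (dyck_paths n)) = fps_nth (catalan_gf :: 'a::field_char_0 fps) n"
proof (induction n rule: less_induct)
  case (less n)
  show ?case
  proof (cases n)
    case 0
    then show ?thesis by (simp add: dyck_paths_0 catalan_gf_def)
  next
    case (Suc m)
    have "fps_nth (catalan_gf :: 'a fps) n =
        (\<Sum>k\<le>m. fps_nth catalan_gf k * fps_nth catalan_gf (m - k))"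
    proof -
      have "fps_nth (catalan_gf :: 'a fps) n = fps_nth (1 + fps_X * catalan_gf ^ 2 :: 'a fps) n"
        by (rule arg_cong[OF catalan_gf_quadratic])
      also have "\<dots> = fps_nth (catalan_gf ^ 2) m" by (simp add: Suc)
      finally show ?thesis by (simp add: power2_eq_square fps_mult_nth atLeast0AtMost)
    qed
    also have "\<dots> = (\<Sum>k\<le>m. of_nat (card (dyck_paths k)) * of_nat (card (dyck_paths (m - k))))"
      by (intro sum.cong refl arg_cong2[of _ _ _ _ "(*)"] less[symmetric]) (auto simp: Suc)
    finally show ?thesis by (simp add: Suc card_dyck_paths_Suc)
  qed
qed

lemma fps_sqrt_eqI:
  fixes f g :: "'a::field_char_0 fps"
  assumes "g ^ 2 = f" "fps_nth g 0 = 1"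
  shows "fps_sqrt f = g"
proof -
  have "fps_nth f 0 = 1"
    using assms by (auto simp: power2_eq_square)
  note sqrt = fps_sqrt[OF this]
  show ?thesis
    by (rule fps_square_eq_imp_eq[OF _ sqrt(2) assms(2)]) (simp only: sqrt(1) assms(1))
qed

text \<open>
  Substituting \<open>w\<close> into the quadratic equation makes the right-hand side a square root of
  \<open>1 - 4 w\<close>. A vanishing constant term makes the substitution a ring homomorphism and selects the
  root with constant term 1.
\<close>

lemma fps_sqrt_catalan:
  fixes w :: "'a::field_char_0 fps"
  assumes "fps_nth w 0 = 0"
  shows "fps_sqrt (1 - 4 * w) = 1 - 2 * w * fps_compose catalan_gf w"
proof (rule fps_sqrt_eqI)
  have "fps_compose catalan_gf w = 1 + w * fps_compose catalan_gf w ^ 2"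
    using arg_cong[OF catalan_gf_quadratic, of "\<lambda>f. fps_compose f w"] assms
    by (simp add: power2_eq_square fps_compose_add_distrib fps_compose_mult_distrib)
  then show "(1 - 2 * w * fps_compose catalan_gf w)\<^sup>2 = 1 - 4 * w"
    by algebra
qed (use assms in simp)

section \<open>The functional equation\<close>

lemma to_fract_of_nat: "to_fract (of_nat n) = of_nat n"
  by (simp add: to_fract_def of_nat_fract)

lemma to_fract_power: "to_fract (a ^ n) = to_fract a ^ n"
  by (induction n) simp_all

text \<open>
  The three parts of the recurrence for the coefficients become products of power series: in the
  last part, \<open>x ^ (2 * Suc k)\<close> supplies the factor \<open>x^2\<close> and rescales the \<open>k\<close>-th Catalan number by
  \<open>(x^2)^k\<close>, which is the substitution of \<open>x^2 z\<close>.
\<close>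

lemma dyck_gf_functional_equation:
  "dyck_gf = catalan_gf + fps_x * fps_y * fps_X * catalan_gf * dyck_gf
     + fps_x ^ 2 * fps_X * fps_compose catalan_gf (fps_x ^ 2 * fps_X) * dyck_gf"
    (is "_ = ?R")
proof (rule fps_ext)
  fix n
  define X Y where "X = to_fract poly_x" and "Y = to_fract poly_y"
  have x: "fps_x = fps_const X" and y: "fps_y = fps_const Y"
    by (simp_all add: fps_x_def fps_y_def X_def Y_def to_fract_def)
  have d: "fps_nth dyck_gf m = to_fract (dyck_coeff m)" for m
    by (simp add: dyck_gf_def to_fract_def)
  have compose: "fps_compose catalan_gf (fps_x ^ 2 * fps_X) =
      Abs_fps (\<lambda>n. X ^ (2 * n) * fps_nth catalan_gf n)"
    by (simp add: x fps_const_power fps_compose_linear power_mult)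
  show "fps_nth dyck_gf n = fps_nth ?R n"
  proof (cases n)
    case 0
    then show ?thesis
      by (simp add: d dyck_coeff_0 catalan_gf_def x y mult.assoc)
  next
    case (Suc m)
    let ?C2 = "Abs_fps (\<lambda>n. X ^ (2 * n) * fps_nth catalan_gf n)"
    have "?R = catalan_gf + fps_const (X * Y) * (fps_X * (dyck_gf * catalan_gf))
        + fps_const (X ^ 2) * (fps_X * (?C2 * dyck_gf))"
      unfolding compose unfolding x y
      by (simp only: fps_const_power fps_const_mult[symmetric] mult_ac)
    then have "fps_nth ?R n = fps_nth catalan_gf (Suc m)
        + X * Y * fps_nth (dyck_gf * catalan_gf) m + X ^ 2 * fps_nth (?C2 * dyck_gf) m"
      by (simp only: fps_add_nth fps_mult_left_const_nth fps_X_mult_nth Suc) simp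
    also have "\<dots> = fps_nth catalan_gf (Suc m)
        + X * Y * (\<Sum>k\<le>m. to_fract (dyck_coeff k) * fps_nth catalan_gf (m - k))
        + X ^ 2 * (\<Sum>k\<le>m. X ^ (2 * k) * fps_nth catalan_gf k * to_fract (dyck_coeff (m - k)))"
      by (simp add: fps_mult_nth d atLeast0AtMost)
    also have "\<dots> = to_fract (dyck_coeff (Suc m))"
      unfolding dyck_coeff_Suc
      by (simp add: to_fract_of_nat to_fract_power of_nat_card_dyck_paths X_def Y_def
          sum_distrib_left mult_ac power_add power2_eq_square)
    finally show ?thesis by (simp add: Suc d)
  qed
qed

theorem theorem3p1:
  fixes x y z :: series
  assumes "x = fps_x" and "y = fps_y" and "z = fps_X"
  shows
    "dyck_gf =
       catalan_gf /
         (1 - x * y * z * catalan_gf - x^2 * z * fps_compose catalan_gf (x^2 * z)) \<and>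
     catalan_gf /
         (1 - x * y * z * catalan_gf - x^2 * z * fps_compose catalan_gf (x^2 * z)) =
       (1 - fps_sqrt (1 - 4 * z)) /
         (z * (1 - x * y + x * y * fps_sqrt (1 - 4 * z) + fps_sqrt (1 - 4 * x^2 * z)))"
proof -
  define C where "C = (catalan_gf :: series)"
  define C2 where "C2 = fps_compose C (x^2 * z)"
  define Den where "Den = 1 - x * y * z * C - x^2 * z * C2"
  \<comment> \<open>A nonzero denominator suffices for cancelling: \<open>2 * z * Den\<close> has constant term 0 and is not
    invertible, so the second quotient is an exact division.\<close>
  have "fps_nth Den 0 = 1"
    by (simp add: Den_def assms(3) mult.assoc)
  then have Den: "Den \<noteq> 0" by auto
  have eq: "C = dyck_gf * Den"
    using dyck_gf_functional_equation
    by (simp add: Den_def C2_def C_def assms algebra_simps)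
  have S: "fps_sqrt (1 - 4 * z) = 1 - 2 * z * C"
    using fps_sqrt_catalan[of z] by (simp add: C_def assms(3))
  have S2: "fps_sqrt (1 - 4 * x^2 * z) = 1 - 2 * (x^2 * z) * C2"
    using fps_sqrt_catalan[of "x^2 * z"] by (simp add: C_def C2_def assms(3) mult.assoc)
  have E: "z * (1 - x * y + x * y * fps_sqrt (1 - 4 * z) + fps_sqrt (1 - 4 * x^2 * z)) = 2 * z * Den"
    unfolding S S2 Den_def by (simp add: algebra_simps)
  have nz: "2 * z * Den \<noteq> 0" using Den by (simp add: assms(3))
  have "1 - fps_sqrt (1 - 4 * z) = dyck_gf * (2 * z * Den)"
    unfolding S eq by (simp add: mult_ac)
  then have "(1 - fps_sqrt (1 - 4 * z)) / (2 * z * Den) = dyck_gf"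
    using nonzero_mult_div_cancel_right[OF nz] by (rule ssubst)
  moreover have "C / Den = dyck_gf"
    unfolding eq by (rule nonzero_mult_div_cancel_right[OF Den])
  ultimately show ?thesis
    unfolding E C_def[symmetric] C2_def[symmetric] Den_def[symmetric] by (simp only: simp_thms)
qed

end
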